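(* Let $\langle P,\leq,{}^\bot,\&\rangle$ be a Sasaki orthoposet, and define the binary operation $\wedge_\& : P^2\to P$ by $$ a\wedge_\& b = (a^\bot \,\&\, b)^\bot \,\&\, b . $$ Then $\langle P,\leq,{}^\bot,\wedge_\&\rangle$ is an orthomodular lattice; that is, $\langle P,\le\rangle$ is a lattice whose meet operation is $\wedge_\&$, and with ${}^\bot$ it is an orthomodular lattice.
   Context: A bounded orthoposet $\langle P,\leq,{}^\bot\rangle$ is a partially ordered set with least element $0$ and greatest element $1$ and an orthocomplementation $a\mapsto a^\bot$, i.e. an order-reversing involution ($a\le b\Rightarrow b^\bot\le a^\bot$, $a^{\bot\bot}=a$) such that for every $a$ the meet of $a$ and $a^\bot$ exists and is $0$, and their join exists and is $1$. An ortholattice is a bounded orthoposet that is a lattice. An orthomodular lattice is an ortholattice in which $a\leq b$ implies $a=b\wedge(a\vee b^\bot)$. A Sasaki orthoposet is a tuple $\langle P,\leq,{}^\bot,\&\rangle$ where $\langle P,\leq,{}^\bot\rangle$ is a bounded orthoposet and $\&:P^2\to P$ is a total binary operation such that for all $a,b,c\in P$: (L-Monotony) $a\le b \Rightarrow a\,\&\,c\le b\,\&\,c$; (R-Reduction) $a\,\&\,b\le b$; (Orthomodularity) $a\le b\Rightarrow a=a\,\&\,b$; (Galois) $a\,\&\,b\le c\Rightarrow c^\bot\,\&\,b\le a^\bot$. *)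

theory Defs
  imports "HOL-Algebra.Lattice" "HOL-Library.Complemented_Lattices"
begin

record 'a ortho_structure = "'a gorder" +
  ocompl :: "'a \<Rightarrow> 'a"  (\<open>_\<^sup>\<bottom>\<index>\<close> [1000] 1000)

record 'a sasaki_structure = "'a ortho_structure" +
  sasaki :: "'a \<Rightarrow> 'a \<Rightarrow> 'a"  (infixl \<open>\<^bold>&\<index>\<close> 70)

locale bounded_orthoposet =
  partial_order L + weak_partial_order_bottom L + weak_partial_order_top L
  for L :: "('a, 'b) ortho_structure_scheme" (structure) +
  assumes ocompl_closed: "a \<in> carrier L \<Longrightarrow> a\<^sup>\<bottom> \<in> carrier L"
    and ocompl_antimono:
      "\<lbrakk>a \<in> carrier L; b \<in> carrier L; a \<sqsubseteq> b\<rbrakk> \<Longrightarrow> b\<^sup>\<bottom> \<sqsubseteq> a\<^sup>\<bottom>"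
    and ocompl_involution: "a \<in> carrier L \<Longrightarrow> a\<^sup>\<bottom>\<^sup>\<bottom> = a"
    and ocompl_meet: "a \<in> carrier L \<Longrightarrow> greatest L \<bottom> (Lower L {a, a\<^sup>\<bottom>})"
    and ocompl_join: "a \<in> carrier L \<Longrightarrow> least L \<top> (Upper L {a, a\<^sup>\<bottom>})"

locale ortholattice = bounded_orthoposet L + lattice L
  for L :: "('a, 'b) ortho_structure_scheme" (structure)

locale orthomodular_lattice = ortholattice L
  for L :: "('a, 'b) ortho_structure_scheme" (structure) +
  assumes orthomodular:
    "\<lbrakk>a \<in> carrier L; b \<in> carrier L; a \<sqsubseteq> b\<rbrakk> \<Longrightarrow> a = b \<sqinter> (a \<squnion> b\<^sup>\<bottom>)"

locale sasaki_orthoposet = bounded_orthoposet L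
  for L :: "('a, 'b) sasaki_structure_scheme" (structure) +
  assumes sasaki_closed:
      "\<lbrakk>a \<in> carrier L; b \<in> carrier L\<rbrakk> \<Longrightarrow> a \<^bold>& b \<in> carrier L"
    and l_monotony:
      "\<lbrakk>a \<in> carrier L; b \<in> carrier L; c \<in> carrier L; a \<sqsubseteq> b\<rbrakk> \<Longrightarrow> a \<^bold>& c \<sqsubseteq> b \<^bold>& c"
    and r_reduction:
      "\<lbrakk>a \<in> carrier L; b \<in> carrier L\<rbrakk> \<Longrightarrow> a \<^bold>& b \<sqsubseteq> b"
    and orthomodularity:
      "\<lbrakk>a \<in> carrier L; b \<in> carrier L; a \<sqsubseteq> b\<rbrakk> \<Longrightarrow> a = a \<^bold>& b"
    and galois:
      "\<lbrakk>a \<in> carrier L; b \<in> carrier L; c \<in> carrier L; a \<^bold>& b \<sqsubseteq> c\<rbrakk>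
        \<Longrightarrow> c\<^sup>\<bottom> \<^bold>& b \<sqsubseteq> a\<^sup>\<bottom>"

definition sasaki_meet ::
    "('a, 'b) sasaki_structure_scheme \<Rightarrow> 'a \<Rightarrow> 'a \<Rightarrow> 'a"  (infixl \<open>\<and>\<^sub>&\<index>\<close> 70)
  where "a \<and>\<^sub>&\<^bsub>L\<^esub> b = (a\<^sup>\<bottom>\<^bsub>L\<^esub> \<^bold>&\<^bsub>L\<^esub> b)\<^sup>\<bottom>\<^bsub>L\<^esub> \<^bold>&\<^bsub>L\<^esub> b"

text \<open>The library's class of orthomodular lattices states the orthomodular law in the dual
  form \<open>x \<le> y \<Longrightarrow> x \<squnion> (- x \<sqinter> y) = y\<close> and lives on whole types.  The two notions agree there:\<close>

lemma (in orthomodular_lattice) class_orthomodular_lattice: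
  assumes U: "carrier L = UNIV"
  shows "class.orthomodular_lattice (\<lambda>x y. x \<sqinter> y\<^sup>\<bottom>) (ocompl L)
    (\<sqinter>) (\<sqsubseteq>) (\<sqsubset>) (\<squnion>) \<bottom> \<top>"
proof -
  have inv: "x\<^sup>\<bottom>\<^sup>\<bottom> = x" for x
    by (simp add: ocompl_involution U)
  have anti: "x \<sqsubseteq> y \<Longrightarrow> y\<^sup>\<bottom> \<sqsubseteq> x\<^sup>\<bottom>" for x y
    by (simp add: ocompl_antimono U)
  have tr: "x \<sqsubseteq> y \<Longrightarrow> y \<sqsubseteq> z \<Longrightarrow> x \<sqsubseteq> z" for x y z
    using le_trans[of x y z] by (simp add: U)
  have as: "x \<sqsubseteq> y \<Longrightarrow> y \<sqsubseteq> x \<Longrightarrow> x = y" for x y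
    by (simp add: le_antisym U)
  have m: "x \<sqinter> y \<sqsubseteq> x" "x \<sqinter> y \<sqsubseteq> y" for x y
    by (simp_all add: meet_left meet_right U)
  have mg: "z \<sqsubseteq> x \<Longrightarrow> z \<sqsubseteq> y \<Longrightarrow> z \<sqsubseteq> x \<sqinter> y" for x y z
    by (simp add: meet_le U)
  have j: "x \<sqsubseteq> x \<squnion> y" "y \<sqsubseteq> x \<squnion> y" for x y
    by (simp_all add: join_left join_right U)
  have jl: "x \<sqsubseteq> z \<Longrightarrow> y \<sqsubseteq> z \<Longrightarrow> x \<squnion> y \<sqsubseteq> z" for x y z
    by (simp add: join_le U)
  have bot: "\<bottom> \<sqsubseteq> x" and top: "x \<sqsubseteq> \<top>" for x
    by (simp_all add: bottom_lower top_higher U)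
  have cm: "x \<sqinter> x\<^sup>\<bottom> = \<bottom>" for x
    using ocompl_meet[of x] m[of x "x\<^sup>\<bottom>"] bot
    by (auto intro!: as simp: greatest_def Lower_def U)
  have cj: "x \<squnion> x\<^sup>\<bottom> = \<top>" for x
    using ocompl_join[of x] j(1)[of x "x\<^sup>\<bottom>"] j(2)[of "x\<^sup>\<bottom>" x] top
    by (auto intro!: as simp: least_def Upper_def U)
  have dm: "(x \<sqinter> y)\<^sup>\<bottom> = x\<^sup>\<bottom> \<squnion> y\<^sup>\<bottom>" for x y
  proof (rule as)
    have "(x\<^sup>\<bottom> \<squnion> y\<^sup>\<bottom>)\<^sup>\<bottom> \<sqsubseteq> x \<sqinter> y"
      using anti[OF j(1)[of "x\<^sup>\<bottom>" "y\<^sup>\<bottom>"]] anti[OF j(2)[of "y\<^sup>\<bottom>" "x\<^sup>\<bottom>"]]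
      by (auto intro: mg simp: inv)
    from anti[OF this] show "(x \<sqinter> y)\<^sup>\<bottom> \<sqsubseteq> x\<^sup>\<bottom> \<squnion> y\<^sup>\<bottom>" by (simp add: inv)
    show "x\<^sup>\<bottom> \<squnion> y\<^sup>\<bottom> \<sqsubseteq> (x \<sqinter> y)\<^sup>\<bottom>" by (intro jl anti m)
  qed
  have dj: "(x \<squnion> y)\<^sup>\<bottom> = x\<^sup>\<bottom> \<sqinter> y\<^sup>\<bottom>" for x y
    using dm[of "x\<^sup>\<bottom>" "y\<^sup>\<bottom>"] by (metis inv)
  have om: "x \<squnion> (x\<^sup>\<bottom> \<sqinter> y) = y" if "x \<sqsubseteq> y" for x y
  proof -
    have "y\<^sup>\<bottom> = x\<^sup>\<bottom> \<sqinter> (y\<^sup>\<bottom> \<squnion> x\<^sup>\<bottom>\<^sup>\<bottom>)"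
      using orthomodular[of "y\<^sup>\<bottom>" "x\<^sup>\<bottom>"] anti[OF that] by (simp add: U)
    also have "\<dots> = (x \<squnion> (x\<^sup>\<bottom> \<sqinter> y))\<^sup>\<bottom>"
      by (simp add: dj dm inv join_comm)
    finally show ?thesis by (metis inv)
  qed
  show ?thesis
  proof
    show "x \<sqsubset> y \<longleftrightarrow> x \<sqsubseteq> y \<and> \<not> y \<sqsubseteq> x" for x y
      using as[of x y] by (auto simp: lless_def eq_is_equal U)
    show "x \<sqsubseteq> x" for x by (simp add: U)
  qed (fact tr as m mg j jl bot top cm cj inv anti om HOL.refl)+
qed

lemma orthomodular_latticeI_class:
  fixes L :: "('a, 'b) ortho_structure_scheme" (structure)
  assumes U: "carrier L = UNIV" and eq: "(.=) = (=)"
    and C: "class.orthomodular_lattice dif (ocompl L) inf' (\<sqsubseteq>) lt sup' b t"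
  shows "orthomodular_lattice L"
proof -
  interpret C: Complemented_Lattices.orthomodular_lattice dif "ocompl L" inf' "(\<sqsubseteq>)" lt sup' b t
    by (rule C)
  interpret partial_order L
    by unfold_locales (auto simp: eq intro: C.order.trans C.order.antisym)
  have g: "greatest L (inf' x y) (Lower L {x, y})" for x y
    by (auto simp: greatest_def Lower_def U)
  have l: "least L (sup' x y) (Upper L {x, y})" for x y
    by (auto simp: least_def Upper_def U)
  interpret lattice L
    by unfold_locales (use g l in blast)+
  have B: "least L b (carrier L)" and T: "greatest L t (carrier L)"
    by (auto simp: least_def greatest_def U)
  interpret weak_partial_order_bottom L
    by unfold_locales (use B in blast)
  interpret weak_partial_order_top L
    by unfold_locales (use T in blast)
  have m: "x \<sqinter> y = inf' x y" for x y
    by (rule C.order.antisym) (auto simp: meet_left meet_right meet_le U)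
  have j: "x \<squnion> y = sup' x y" for x y
    by (rule C.order.antisym) (auto simp: join_left join_right join_le U)
  have bt: "\<bottom> = b" "\<top> = t"
    using B T bottom_least top_greatest
    by (auto intro!: C.order.antisym simp: least_def greatest_def U)
  have om: "x = inf' y (sup' x (y\<^sup>\<bottom>))" if "x \<sqsubseteq> y" for x y
  proof -
    have "y\<^sup>\<bottom> \<sqsubseteq> x\<^sup>\<bottom>" using that by simp
    from C.orthomodular[OF this] have "sup' (y\<^sup>\<bottom>) (inf' y (x\<^sup>\<bottom>)) = x\<^sup>\<bottom>" by simp
    then have "(sup' (y\<^sup>\<bottom>) (inf' y (x\<^sup>\<bottom>)))\<^sup>\<bottom> = x\<^sup>\<bottom>\<^sup>\<bottom>" by simp
    then show ?thesis by (simp add: C.inf_commute C.sup_commute)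
  qed
  show ?thesis
  proof unfold_locales
    fix x y :: 'a
    show "greatest L \<bottom> (Lower L {x, x\<^sup>\<bottom>})"
      using g[of x "x\<^sup>\<bottom>"] by (simp add: bt)
    show "least L \<top> (Upper L {x, x\<^sup>\<bottom>})"
      using l[of x "x\<^sup>\<bottom>"] by (simp add: bt)
    show "x \<sqsubseteq> y \<Longrightarrow> x = y \<sqinter> (x \<squnion> y\<^sup>\<bottom>)"
      by (simp only: m j) (rule om)
  qed (auto simp: U)
qed

end

theory Submission
  imports Defs
begin

text \<open>Write a' for the complement. The Galois axiom makes x |-> (x' & b)' a right adjoint of x
  |-> x & b. So (a' & b)' & b lies below a, and by R-Reduction below b. A common lower bound x of a
  and b is fixed by - & b, so the adjunction puts x below (a' & b)', and L-Monotony puts x = x & b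
  below (a' & b)' & b. This is \<open>sasaki_meet_greatest\<close>; joins follow by De Morgan
  duality (\<open>least_Upper_ocomplI\<close>). The orthomodular law is then a computation with &,
  in \<open>sasaki_meet_orthomodular\<close>: - & b fixes everything below b.\<close>

lemma (in bounded_orthoposet) ocompl_le_swap:
  assumes "a \<in> carrier L" "b \<in> carrier L" "a\<^sup>\<bottom> \<sqsubseteq> b"
  shows "b\<^sup>\<bottom> \<sqsubseteq> a"
  using assms ocompl_antimono[of "a\<^sup>\<bottom>" b] by (simp add: ocompl_closed ocompl_involution)

text \<open>De Morgan: the complement is an order-reversing involution, so it turns greatest lower
  bounds into least upper bounds. It reduces the existence of joins to that of meets.\<close>

lemma (in bounded_orthoposet) least_Upper_ocomplI:
  assumes c: "a \<in> carrier L" "b \<in> carrier L"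
    and g: "greatest L m (Lower L {a\<^sup>\<bottom>, b\<^sup>\<bottom>})"
  shows "least L (m\<^sup>\<bottom>) (Upper L {a, b})"
proof -
  have m: "m \<in> carrier L" "m \<sqsubseteq> a\<^sup>\<bottom>" "m \<sqsubseteq> b\<^sup>\<bottom>"
    using c g by (auto simp: greatest_def Lower_def ocompl_closed)
  have "a \<sqsubseteq> m\<^sup>\<bottom>" "b \<sqsubseteq> m\<^sup>\<bottom>"
    using m c ocompl_antimono[of m "a\<^sup>\<bottom>"] ocompl_antimono[of m "b\<^sup>\<bottom>"]
    by (simp_all add: ocompl_closed ocompl_involution)
  moreover have "m\<^sup>\<bottom> \<sqsubseteq> u" if u: "u \<in> carrier L" "a \<sqsubseteq> u" "b \<sqsubseteq> u" for u
  proof (rule ocompl_le_swap[OF u(1) m(1)])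
    have "u\<^sup>\<bottom> \<in> Lower L {a\<^sup>\<bottom>, b\<^sup>\<bottom>}"
      using u c by (auto simp: Lower_def ocompl_closed ocompl_antimono)
    then show "u\<^sup>\<bottom> \<sqsubseteq> m" using g by (auto simp: greatest_def)
  qed
  ultimately show ?thesis
    using m c by (auto simp: least_def Upper_def ocompl_closed)
qed

lemma (in sasaki_orthoposet) sasaki_meet_closed:
  "\<lbrakk>a \<in> carrier L; b \<in> carrier L\<rbrakk> \<Longrightarrow> a \<and>\<^sub>& b \<in> carrier L"
  by (simp add: sasaki_meet_def sasaki_closed ocompl_closed)

lemma (in sasaki_orthoposet) sasaki_meet_greatest:
  assumes c: "a \<in> carrier L" "b \<in> carrier L"
  shows "greatest L (a \<and>\<^sub>& b) (Lower L {a, b})"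
proof -
  have "a \<and>\<^sub>& b \<sqsubseteq> b"
    using c by (simp add: sasaki_meet_def r_reduction sasaki_closed ocompl_closed)
  \<comment> \<open>Galois with c chosen as a' & b itself, so that its premise is
    reflexivity.\<close>
  moreover have "a \<and>\<^sub>& b \<sqsubseteq> a"
    using c galois[of "a\<^sup>\<bottom>" b "a\<^sup>\<bottom> \<^bold>& b"]
    by (simp add: sasaki_meet_def sasaki_closed ocompl_closed ocompl_involution)
  moreover have "x \<sqsubseteq> a \<and>\<^sub>& b" if x: "x \<in> carrier L" "x \<sqsubseteq> a" "x \<sqsubseteq> b" for x
  proof -
    have xb: "x \<^bold>& b = x" using orthomodularity[of x b] x c by simp
    have "a\<^sup>\<bottom> \<^bold>& b \<sqsubseteq> x\<^sup>\<bottom> \<^bold>& b"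
      using x c by (simp add: l_monotony ocompl_antimono ocompl_closed)
    \<comment> \<open>Galois applied to x & b \<sqsubseteq> x, which holds because x is fixed by - &
      b.\<close>
    also have "x\<^sup>\<bottom> \<^bold>& b \<sqsubseteq> x\<^sup>\<bottom>"
      using x c xb by (simp add: galois)
    finally have "a\<^sup>\<bottom> \<^bold>& b \<sqsubseteq> x\<^sup>\<bottom>"
      using x c by (simp add: sasaki_closed ocompl_closed)
    then have "x \<sqsubseteq> (a\<^sup>\<bottom> \<^bold>& b)\<^sup>\<bottom>"
      using x c ocompl_antimono[of "a\<^sup>\<bottom> \<^bold>& b" "x\<^sup>\<bottom>"]
      by (simp add: sasaki_closed ocompl_closed ocompl_involution)
    then have "x \<^bold>& b \<sqsubseteq> a \<and>\<^sub>& b"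
      using x c by (simp add: sasaki_meet_def l_monotony sasaki_closed ocompl_closed)
    then show ?thesis by (simp add: xb)
  qed
  ultimately show ?thesis
    using c by (auto simp: greatest_def Lower_def sasaki_meet_closed)
qed

lemma (in sasaki_orthoposet) sasaki_meet_eq_left:
  assumes c: "a \<in> carrier L" "b \<in> carrier L" and "a \<sqsubseteq> b"
  shows "a \<and>\<^sub>& b = a"
proof (rule le_antisym)
  show "a \<and>\<^sub>& b \<sqsubseteq> a" "a \<sqsubseteq> a \<and>\<^sub>& b"
    using sasaki_meet_greatest[OF c] assms by (auto simp: greatest_def Lower_def)
qed (use c in \<open>simp_all add: sasaki_meet_closed\<close>)

text \<open>This is the orthomodular law, since \<open>(a\<^sup>\<bottom> \<and>\<^sub>& b)\<^sup>\<bottom>\<close> is the join of \<open>a\<close> and \<open>b\<^sup>\<bottom>\<close>.\<close>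

lemma (in sasaki_orthoposet) sasaki_meet_orthomodular:
  assumes c: "a \<in> carrier L" "b \<in> carrier L" and ab: "a \<sqsubseteq> b"
  shows "(a\<^sup>\<bottom> \<and>\<^sub>& b)\<^sup>\<bottom> \<and>\<^sub>& b = a"
proof -
  \<comment> \<open>Unfolding gives (a'' & b)' & b, and a'' & b = a & b = a since a \<sqsubseteq>
    b.\<close>
  have d: "a\<^sup>\<bottom> \<and>\<^sub>& b = a\<^sup>\<bottom> \<^bold>& b"
    using orthomodularity[of a b] assms by (simp add: sasaki_meet_def ocompl_involution)
  have "(a\<^sup>\<bottom> \<^bold>& b) \<^bold>& b = a\<^sup>\<bottom> \<^bold>& b"
    using orthomodularity[of "a\<^sup>\<bottom> \<^bold>& b" b] c
    by (simp add: sasaki_closed ocompl_closed r_reduction)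
  \<comment> \<open>The two outer complements on the left cancel, and the repeated & b is absorbed;
    what remains, (a' & b)' & b, is \<open>a \<and>\<^sub>& b\<close> by definition.\<close>
  then have "(a\<^sup>\<bottom> \<^bold>& b)\<^sup>\<bottom> \<and>\<^sub>& b = a \<and>\<^sub>& b"
    using c by (simp add: sasaki_meet_def sasaki_closed ocompl_closed ocompl_involution)
  then show ?thesis by (simp add: d sasaki_meet_eq_left assms)
qed

theorem proposition5:
  fixes L :: "('a, 'b) sasaki_structure_scheme" (structure)
  assumes "sasaki_orthoposet L"
  shows "orthomodular_lattice L \<and>
    (\<forall>a \<in> carrier L. \<forall>b \<in> carrier L. a \<and>\<^sub>& b = a \<sqinter> b)"
proof -
  interpret sasaki_orthoposet L by (fact assms)
  have join: "least L ((a\<^sup>\<bottom> \<and>\<^sub>& b\<^sup>\<bottom>)\<^sup>\<bottom>) (Upper L {a, b})"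
    if "a \<in> carrier L" "b \<in> carrier L" for a b
    using that by (simp add: least_Upper_ocomplI sasaki_meet_greatest ocompl_closed)
  interpret lattice L
    by unfold_locales (use join sasaki_meet_greatest in blast)+
  \<comment> \<open>The lattice meet is a chosen greatest lower bound; antisymmetry makes it
    unique.\<close>
  have meet_eq: "a \<and>\<^sub>& b = a \<sqinter> b" if "a \<in> carrier L" "b \<in> carrier L" for a b
    using greatest_unique[OF sasaki_meet_greatest[OF that]] that
    by (metis inf_of_two_greatest meet_def)
  have join_eq: "(a\<^sup>\<bottom> \<and>\<^sub>& b\<^sup>\<bottom>)\<^sup>\<bottom> = a \<squnion> b" if "a \<in> carrier L" "b \<in> carrier L" for a b
    using least_unique[OF join[OF that]] that
    by (metis sup_of_two_least join_def)
  have "a = b \<sqinter> (a \<squnion> b\<^sup>\<bottom>)" if "a \<in> carrier L" "b \<in> carrier L" "a \<sqsubseteq> b" for a b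
  proof -
    \<comment> \<open>De Morgan for a and b', with b'' = b.\<close>
    have "a \<squnion> b\<^sup>\<bottom> = (a\<^sup>\<bottom> \<and>\<^sub>& b)\<^sup>\<bottom>"
      using join_eq[of a "b\<^sup>\<bottom>"] that by (simp add: ocompl_closed ocompl_involution)
    moreover have "(a\<^sup>\<bottom> \<and>\<^sub>& b)\<^sup>\<bottom> \<sqinter> b = a"
      using sasaki_meet_orthomodular[OF that] that
      by (simp add: meet_eq[symmetric] sasaki_meet_closed ocompl_closed)
    ultimately show ?thesis by (simp add: meet_comm)
  qed
  then have "orthomodular_lattice L" by unfold_locales
  then show ?thesis using meet_eq by blast
qed

end
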